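(* Let $n\in\mathbb{N}$ and let $X\subseteq\mathbb{N}$ be a finite set with $\min X\ge 3$. If $X$ is $\omega^{300n}$-large, then $X$ is $\mathrm{RT}^{2}_{2}$-$\omega^{n}$-large: for every colouring $P:[X]^2\to 2$ there is an $\omega^n$-large set $Y\subseteq X$ that is $P$-homogeneous.
   Context: Ordinals $\alpha<\omega^\omega$ are written in Cantor normal form $\alpha=\omega^{n_0}+\dots+\omega^{n_{k-1}}$ with $n_0\ge\dots\ge n_{k-1}$; $1=\omega^0$ and $\omega^n\cdot k$ denotes the sum of $k$ copies of $\omega^n$. For $m\in\mathbb{N}$ define $0[m]=0$, $(\beta+1)[m]=\beta$, and $(\beta+\omega^{n})[m]=\beta+\omega^{n-1}\cdot m$ for $n\ge 1$ (where $\beta+\omega^n$ is in Cantor normal form). A finite set $X=\{x_0<\dots<x_{\ell-1}\}\subseteq\mathbb{N}$ is $\alpha$-large if $\alpha[x_0][x_1]\cdots[x_{\ell-1}]=0$. A finite set $X$ is $\mathrm{RT}^2_2$-$\alpha$-large if for every $P:[X]^2\to 2$ there is an $\alpha$-large $P$-homogeneous $Y\subseteq X$. *)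

theory Defs
  imports Main
begin

text \<open>Ordinals below omega^omega in Cantor normal form
  omega^(n_0) + ... + omega^(n_(k-1)), n_0 >= ... >= n_(k-1),
  are represented by the list [n_0, ..., n_(k-1)] of exponents.\<close>

definition cnf :: "nat list \<Rightarrow> bool" where
  "cnf a \<longleftrightarrow> sorted (rev a)"

definition omega_pow :: "nat \<Rightarrow> nat list" where
  "omega_pow n = [n]"

definition fund :: "nat list \<Rightarrow> nat \<Rightarrow> nat list" where
  "fund a m = (if a = [] then []
     else if last a = 0 then butlast a
     else butlast a @ replicate m (last a - 1))"

definition large :: "nat list \<Rightarrow> nat set \<Rightarrow> bool" where
  "large a X \<longleftrightarrow> foldl fund a (sorted_list_of_set X) = []"

text \<open>A colouring P : [X]^2 \<rightarrow> 2 is given as a function on pairs x<y.\<close>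
definition homogeneous :: "(nat \<Rightarrow> nat \<Rightarrow> bool) \<Rightarrow> nat set \<Rightarrow> bool" where
  "homogeneous P Y \<longleftrightarrow> (\<exists>c. \<forall>x\<in>Y. \<forall>y\<in>Y. x < y \<longrightarrow> P x y = c)"

definition RT22_large :: "nat list \<Rightarrow> nat set \<Rightarrow> bool" where
  "RT22_large a X \<longleftrightarrow> (\<forall>P :: nat \<Rightarrow> nat \<Rightarrow> bool.
      \<exists>Y \<subseteq> X. large a Y \<and> homogeneous P Y)"

end

theory Submission
  imports Defs
begin

text \<open>
  Call blocks \<open>F\<^sub>0 < F\<^sub>1 < \<dots>\<close> a grouping if the colour of a pair taken from two different blocks
  depends only on the two blocks. Colouring a point by the vector of its colours towards all smaller
  points (or towards finitely many later blocks) and using the pigeonhole principle, an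
  \<open>\<omega>\<^bsup>k+9\<^esup>\<close>-large set contains a grouping of \<open>\<omega>\<^bsup>k\<^esup>\<close>-large blocks whose set of maxima is
  \<open>\<omega>\<close>-large. Groupings can be nested, so \<open>\<omega>\<^bsup>k+81\<^esup>\<close>-large sets contain groupings whose maxima form
  an \<open>\<omega>\<^bsup>9\<^esup>\<close>-large set; the colouring induced on the maxima then has an \<open>\<omega>\<close>-large homogeneous set,
  that is, \<open>\<omega>\<close>-many blocks with all cross pairs of one colour. By induction on \<open>a + b\<close>, an
  \<open>\<omega>\<^bsup>81(a+b)\<^esup>\<close>-large set has an \<open>\<omega>\<^bsup>a\<^esup>\<close>-large homogeneous subset of the first colour or an
  \<open>\<omega>\<^bsup>b\<^esup>\<close>-large one of the second: apply the induction hypothesis, with the exponent of the colour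
  of the cross pairs decreased, inside every block. Take \<open>a = b = n\<close>.
\<close>

section \<open>Sets that are large for a power of omega\<close>

definition sep :: "nat set \<Rightarrow> nat set \<Rightarrow> bool" (infix "\<lless>" 50) where
  "A \<lless> B \<longleftrightarrow> (\<forall>x\<in>A. \<forall>y\<in>B. x < y)"

definition blocks :: "(nat set \<Rightarrow> bool) \<Rightarrow> nat \<Rightarrow> nat set \<Rightarrow> bool" where
  "blocks p m X \<longleftrightarrow> (\<exists>B. (\<forall>i<m. B i \<subseteq> X \<and> p (B i)) \<and> (\<forall>i j. i < j \<longrightarrow> j < m \<longrightarrow> B i \<lless> B j))"

text \<open>Means that \<open>X\<close> contains an \<open>omega^n\<close>-large subset, and is
  closed under supersets by design. In the successor case \<open>x\<close> plays the first point,
  and the \<open>x\<close> blocks above it stand for \<open>omega^n * x\<close>. Fundamental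
  sequences are thus kept out of the combinatorics.\<close>

primrec omega_large :: "nat \<Rightarrow> nat set \<Rightarrow> bool" where
  "omega_large 0 = (\<lambda>X. X \<noteq> {})"
| "omega_large (Suc n) = (\<lambda>X. \<exists>x\<in>X. blocks (omega_large n) x (X \<inter> {x<..}))"

lemma sepD: "A \<lless> B \<Longrightarrow> x \<in> A \<Longrightarrow> y \<in> B \<Longrightarrow> x < y"
  by (auto simp: sep_def)

lemma sep_subset: "A \<lless> B \<Longrightarrow> A' \<subseteq> A \<Longrightarrow> B' \<subseteq> B \<Longrightarrow> A' \<lless> B'"
  unfolding sep_def by blast

lemma blocks_mono:
  assumes "blocks p m X" "X \<subseteq> Y" "m' \<le> m"
  shows "blocks p m' Y"
proof -
  from assms(1) obtain B where "\<forall>i<m. B i \<subseteq> X \<and> p (B i)" "\<forall>i j. i < j \<longrightarrow> j < m \<longrightarrow> B i \<lless> B j"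
    unfolding blocks_def by blast
  with assms(2,3) show ?thesis
    unfolding blocks_def by (intro exI[of _ B]) (simp add: subset_trans[of _ X Y])
qed

lemma blocks_0 [simp]: "blocks p 0 X"
  by (simp add: blocks_def)

lemma blocks_split:
  assumes "blocks p (s + t) X"
  obtains U V where "U \<subseteq> X" "V \<subseteq> X" "U \<lless> V" "blocks p s U" "blocks p t V"
proof -
  from assms obtain B where B: "\<And>i. i < s + t \<Longrightarrow> B i \<subseteq> X \<and> p (B i)"
    "\<And>i j. i < j \<Longrightarrow> j < s + t \<Longrightarrow> B i \<lless> B j"
    unfolding blocks_def by blast
  show thesis
  proof
    show "(\<Union>i<s. B i) \<subseteq> X" using B(1) by (intro UN_least) simp
    show "(\<Union>i<t. B (s + i)) \<subseteq> X" using B(1) by (intro UN_least) simp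
    show "(\<Union>i<s. B i) \<lless> (\<Union>i<t. B (s + i))"
      unfolding sep_def
    proof (intro ballI)
      fix x y assume "x \<in> (\<Union>i<s. B i)" "y \<in> (\<Union>i<t. B (s + i))"
      then obtain i j where ij: "i < s" "j < t" "x \<in> B i" "y \<in> B (s + j)" by auto
      then have "B i \<lless> B (s + j)" by (intro B(2)) auto
      then show "x < y" using ij(3,4) by (rule sepD)
    qed
    show "blocks p s (\<Union>i<s. B i)"
      unfolding blocks_def by (intro exI[of _ B]) (use B in auto)
    show "blocks p t (\<Union>i<t. B (s + i))"
      unfolding blocks_def by (intro exI[of _ "\<lambda>i. B (s + i)"]) (use B in auto)
  qed
qed

lemma blocks_join:
  assumes "blocks p s U" "blocks p t V" "U \<lless> V"
  shows "blocks p (s + t) (U \<union> V)"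
proof -
  from assms(1) obtain B where B: "\<And>i. i < s \<Longrightarrow> B i \<subseteq> U \<and> p (B i)"
    "\<And>i j. i < j \<Longrightarrow> j < s \<Longrightarrow> B i \<lless> B j"
    unfolding blocks_def by blast
  from assms(2) obtain D where D: "\<And>i. i < t \<Longrightarrow> D i \<subseteq> V \<and> p (D i)"
    "\<And>i j. i < j \<Longrightarrow> j < t \<Longrightarrow> D i \<lless> D j"
    unfolding blocks_def by blast
  define E where "E i = (if i < s then B i else D (i - s))" for i
  have "E i \<subseteq> U \<union> V \<and> p (E i)" if "i < s + t" for i
  proof (cases "i < s")
    case True
    then show ?thesis using B(1)[of i] by (auto simp: E_def)
  next
    case False
    then have "i - s < t" using that by linarith
    then show ?thesis using D(1)[of "i - s"] False by (auto simp: E_def)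
  qed
  moreover have "E i \<lless> E j" if "i < j" "j < s + t" for i j
  proof -
    consider "j < s" | "i < s" "s \<le> j" | "s \<le> i" using that by linarith
    then show ?thesis
    proof cases
      case 1
      then show ?thesis using that B(2) by (auto simp: E_def)
    next
      case 2
      then show ?thesis
        using B(1)[of i] D(1)[of "j - s"] that sep_subset[OF assms(3)] by (auto simp: E_def)
    next
      case 3
      then show ?thesis using that D(2)[of "i - s" "j - s"] by (auto simp: E_def)
    qed
  qed
  ultimately show ?thesis unfolding blocks_def by blast
qed

lemma omega_large_0 [simp]: "omega_large 0 X \<longleftrightarrow> X \<noteq> {}"
  by simp

lemma omega_large_mono:
  assumes "omega_large n X" "X \<subseteq> Y"
  shows "omega_large n Y"
proof (cases n)
  case 0
  with assms show ?thesis by auto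
next
  case (Suc m)
  with assms(1) obtain x where x: "x \<in> X" "blocks (omega_large m) x (X \<inter> {x<..})" by auto
  have "blocks (omega_large m) x (Y \<inter> {x<..})" using assms(2) by (intro blocks_mono[OF x(2)]) auto
  with x(1) Suc assms(2) show ?thesis by auto
qed

lemma omega_large_nonempty: "omega_large n X \<Longrightarrow> X \<noteq> {}"
  by (cases n) auto

lemma blocks_Suc_0 [simp]: "blocks (omega_large n) (Suc 0) X \<longleftrightarrow> omega_large n X"
  using omega_large_mono by (auto simp: blocks_def)

lemma blocks_SucE:
  assumes "blocks (omega_large n) (Suc m) X"
  obtains U V where "U \<subseteq> X" "V \<subseteq> X" "U \<lless> V" "omega_large n U" "blocks (omega_large n) m V"
  using blocks_split[of "omega_large n" 1 m X] assms by auto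

lemma omega_large_SucE:
  assumes "omega_large (Suc n) X"
  obtains x where "x \<in> X" "blocks (omega_large n) x (X \<inter> {x<..})"
  using assms by auto

lemma omega_large_SucI: "x \<in> X \<Longrightarrow> blocks (omega_large n) x A \<Longrightarrow> A \<subseteq> X \<Longrightarrow> {x} \<lless> A \<Longrightarrow> omega_large (Suc n) X"
  by (auto simp: sep_def intro!: bexI[of _ x] blocks_mono[of _ x A])

declare omega_large.simps [simp del]

lemma omega_large_pred: "omega_large (Suc n) X \<Longrightarrow> X \<subseteq> {3..} \<Longrightarrow> omega_large n X"
proof -
  assume "omega_large (Suc n) X" and X: "X \<subseteq> {3..}"
  then obtain x where x: "x \<in> X" "blocks (omega_large n) x (X \<inter> {x<..})" by (auto elim: omega_large_SucE)
  with X have "0 < x" by force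
  with x(2) show ?thesis unfolding blocks_def using omega_large_mono by (metis le_inf_iff)
qed

lemma omega_large_antimono: "omega_large n X \<Longrightarrow> m \<le> n \<Longrightarrow> X \<subseteq> {3..} \<Longrightarrow> omega_large m X"
proof (induction n)
  case 0
  then show ?case by simp
next
  case (Suc n)
  then show ?case using omega_large_pred[of n X] by (cases "m = Suc n") simp_all
qed

section \<open>Agreement with the fundamental sequences\<close>

lemma fund_append: "b \<noteq> [] \<Longrightarrow> fund (a @ b) m = a @ fund b m"
  by (simp add: fund_def butlast_append)

lemma fund_snoc_Suc [simp]: "fund (a @ [Suc n]) m = a @ replicate m n"
  by (simp add: fund_def)

lemma foldl_fund_Nil [simp]: "foldl fund [] xs = []"
  by (induction xs) (simp_all add: fund_def)

text \<open>\<open>fund\<close> rewrites only the end of the list, so the terms of \<open>b\<close>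
  are used up first, by an initial segment \<open>ys\<close>; only then do points act on
  \<open>a\<close>.\<close>

lemma foldl_fund_append_split:
  assumes "foldl fund (a @ b) xs = []"
  obtains ys zs where "xs = ys @ zs" "foldl fund b ys = []" "foldl fund a zs = []"
  using assms
proof (induction xs arbitrary: b thesis)
  case Nil
  then show ?case by force
next
  case (Cons x xs)
  show ?case
  proof (cases "b = []")
    case True
    show ?thesis by (rule Cons.prems(1)[of "[]" "x # xs"]) (use True Cons.prems(2) in auto)
  next
    case False
    then have "foldl fund (a @ fund b x) xs = []"
      using Cons.prems(2) by (simp add: fund_append)
    then obtain ys zs where "xs = ys @ zs" "foldl fund (fund b x) ys = []" "foldl fund a zs = []"
      using Cons.IH by blast
    then show ?thesis by (intro Cons.prems(1)[of "x # ys" zs]) auto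
  qed
qed

lemma large_list_imp_omega_large:
  "foldl fund [n] xs = [] \<Longrightarrow> sorted_wrt (<) xs \<Longrightarrow> omega_large n (set xs)"
proof (induction n arbitrary: xs)
  case 0
  then show ?case by auto
next
  case (Suc n)
  have iterate: "blocks (omega_large n) m (set ys)"
    if "foldl fund (replicate m n) ys = []" "sorted_wrt (<) ys" for m ys
    using that
  proof (induction m arbitrary: ys)
    case 0
    then show ?case by simp
  next
    case (Suc m)
    \<comment> \<open>The last entry of the exponent list is consumed first, so it yields the lowest
      block.\<close>
    have "foldl fund (replicate m n @ [n]) ys = []"
      using Suc.prems(1) by (simp add: replicate_append_same)
    then obtain us vs where uv: "ys = us @ vs" "foldl fund [n] us = []"
        "foldl fund (replicate m n) vs = []"
      using foldl_fund_append_split by blast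
    have "omega_large n (set us)" using \<open>\<And>xs. _ \<Longrightarrow> _ \<Longrightarrow> omega_large n (set xs)\<close> uv Suc.prems(2)
      by (auto simp: sorted_wrt_append)
    moreover have "blocks (omega_large n) m (set vs)"
      using Suc uv by (auto simp: sorted_wrt_append)
    moreover have "set us \<lless> set vs"
      using Suc.prems(2) uv(1) by (auto simp: sorted_wrt_append sep_def)
    ultimately show ?case using blocks_join[of "omega_large n" 1 "set us" m "set vs"] uv(1) by simp
  qed
  obtain x ys where xs: "xs = x # ys" using Suc.prems(1) by (cases xs) auto
  have "blocks (omega_large n) x (set ys)"
    using Suc.prems xs by (intro iterate) (simp_all add: fund_def[of "[Suc n]"])
  then show ?case
    using Suc.prems(2) xs by (intro omega_large_SucI[of x _ _ "set ys"]) (auto simp: sep_def)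
qed

text \<open>Arriving exactly at an arbitrary prefix \<open>a\<close> is what makes the induction
  work: lists for consecutive blocks can be concatenated, each removing precisely one last
  term.\<close>

lemma omega_large_imp_large_list:
  "omega_large n X \<Longrightarrow> \<exists>ys. set ys \<subseteq> X \<and> sorted_wrt (<) ys \<and> (\<forall>a. foldl fund (a @ [n]) ys = a)"
proof (induction n arbitrary: X)
  case 0
  then obtain x where "x \<in> X" by auto
  then show ?case by (intro exI[of _ "[x]"]) (auto simp: fund_def)
next
  case (Suc n)
  have iterate: "\<exists>ys. set ys \<subseteq> V \<and> sorted_wrt (<) ys \<and> (\<forall>a. foldl fund (a @ replicate m n) ys = a)"
    if "blocks (omega_large n) m V" for m V
    using that
  proof (induction m arbitrary: V)
    case 0
    then show ?case by (intro exI[of _ "[]"]) auto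
  next
    case (Suc m)
    obtain A B where AB: "A \<subseteq> V" "B \<subseteq> V" "A \<lless> B" "omega_large n A" "blocks (omega_large n) m B"
      using blocks_SucE[OF Suc.prems] .
    obtain ys where ys: "set ys \<subseteq> A" "sorted_wrt (<) ys" "\<And>a. foldl fund (a @ [n]) ys = a"
      using \<open>\<And>X. omega_large n X \<Longrightarrow> _\<close>[OF AB(4)] by blast
    obtain zs where zs: "set zs \<subseteq> B" "sorted_wrt (<) zs" "\<And>a. foldl fund (a @ replicate m n) zs = a"
      using Suc.IH[OF AB(5)] by blast
    have "a @ replicate (Suc m) n = (a @ replicate m n) @ [n]" for a
      by (simp add: replicate_append_same)
    then have "foldl fund (a @ replicate (Suc m) n) (ys @ zs) = a" for a
      using ys(3)[of "a @ replicate m n"] zs(3)[of a] by (simp only: foldl_append)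
    moreover have "sorted_wrt (<) (ys @ zs)"
      using ys(1,2) zs(1,2) AB(3) by (auto simp: sorted_wrt_append sep_def)
    ultimately show ?case using ys(1) zs(1) AB(1,2) by (intro exI[of _ "ys @ zs"]) auto
  qed
  obtain x where x: "x \<in> X" "blocks (omega_large n) x (X \<inter> {x<..})" using omega_large_SucE[OF Suc.prems] .
  obtain ys where ys: "set ys \<subseteq> X \<inter> {x<..}" "sorted_wrt (<) ys"
      "\<And>a. foldl fund (a @ replicate x n) ys = a"
    using iterate[OF x(2)] by blast
  then have "\<forall>a. foldl fund (a @ [Suc n]) (x # ys) = a" by simp
  then show ?case using x(1) ys(1,2) by (intro exI[of _ "x # ys"]) auto
qed

lemma large_imp_omega_large: "finite X \<Longrightarrow> large (omega_pow n) X \<Longrightarrow> omega_large n X"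
  using large_list_imp_omega_large[of n "sorted_list_of_set X"] by (simp add: large_def omega_pow_def)

lemma omega_large_imp_large:
  assumes "omega_large n X"
  obtains Y where "Y \<subseteq> X" "large (omega_pow n) Y"
proof -
  obtain ys where ys: "set ys \<subseteq> X" "sorted_wrt (<) ys" "\<And>a. foldl fund (a @ [n]) ys = a"
    using omega_large_imp_large_list[OF assms] by blast
  have "sorted_list_of_set (set ys) = ys"
    using ys(2) by (simp add: strict_sorted_equal)
  then have "large (omega_pow n) (set ys)"
    using ys(3)[of "[]"] by (simp add: large_def omega_pow_def)
  with ys(1) show thesis by (rule that)
qed

section \<open>The pigeonhole principle\<close>

lemma weighted_pigeonhole:
  fixes s :: "'c \<Rightarrow> nat"
  assumes "finite I" "finite C" "f ` I \<subseteq> C" "(\<Sum>c\<in>C. s c) < card I"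
  obtains c where "c \<in> C" "s c < card {i\<in>I. f i = c}"
proof (rule ccontr)
  assume "\<not> thesis"
  then have "(\<Sum>c\<in>C. card {i\<in>I. f i = c}) \<le> (\<Sum>c\<in>C. s c)"
    using that by (intro sum_mono) force
  moreover have "card I = (\<Sum>c\<in>C. card {i\<in>I. f i = c})"
    using sum.group[OF assms(1-3), of "\<lambda>_. 1::nat"] by simp
  ultimately show False using assms(4) by simp
qed

lemma blocks_of_card:
  "finite S \<Longrightarrow> m \<le> card S \<Longrightarrow> blocks (omega_large 0) m S"
proof (induction m arbitrary: S)
  case 0
  then show ?case by simp
next
  case (Suc m)
  have ne: "S \<noteq> {}" using Suc.prems(2) by auto
  have "blocks (omega_large 0) m (S - {Min S})"
    using Suc.prems ne by (intro Suc.IH) (simp_all add: card_Diff_singleton)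
  moreover have "blocks (omega_large 0) 1 {Min S}" by simp
  moreover have "{Min S} \<lless> S - {Min S}"
    using Suc.prems(1) by (simp add: sep_def order_less_le)
  ultimately have "blocks (omega_large 0) (1 + m) ({Min S} \<union> (S - {Min S}))" by (intro blocks_join)
  moreover have "{Min S} \<union> (S - {Min S}) = S" using Min_in[OF Suc.prems(1) ne] by blast
  ultimately show ?case by (simp only: plus_1_eq_Suc)
qed

lemma blocks_transversal:
  assumes "blocks (omega_large n) m X"
  obtains r where "\<And>i. i < m \<Longrightarrow> r i \<in> X" "\<And>i j. i < j \<Longrightarrow> j < m \<Longrightarrow> r i < r j"
proof -
  from assms obtain B where B: "\<And>i. i < m \<Longrightarrow> B i \<subseteq> X \<and> omega_large n (B i)"
    "\<And>i j. i < j \<Longrightarrow> j < m \<Longrightarrow> B i \<lless> B j"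
    unfolding blocks_def by blast
  define r where "r i = (SOME x. x \<in> B i)" for i
  have r: "r i \<in> B i" if "i < m" for i
    unfolding r_def using B(1)[OF that] omega_large_nonempty by (metis some_in_eq)
  show thesis
  proof
    show "r i \<in> X" if "i < m" for i using r B(1) that by blast
    show "r i < r j" if "i < j" "j < m" for i j
      using sepD[OF B(2)[OF that] r[of i] r[of j]] that by simp
  qed
qed

lemma blocks_ex_ge:
  assumes "blocks (omega_large n) m X" "0 < m" "X \<subseteq> {x<..}"
  obtains z where "z \<in> X" "x + m \<le> z"
proof -
  obtain r where r: "\<And>i. i < m \<Longrightarrow> r i \<in> X" "\<And>i j. i < j \<Longrightarrow> j < m \<Longrightarrow> r i < r j"
    using blocks_transversal[OF assms(1)] by blast
  have "x + Suc i \<le> r i" if "i < m" for i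
    using that
  proof (induction i)
    case 0
    then show ?case using r(1)[of 0] assms(3) by auto
  next
    case (Suc i)
    then show ?case using r(2)[of i "Suc i"] by simp
  qed
  from this[of "m - 1"] r(1)[of "m - 1"] assms(2) show thesis by (intro that[of "r (m - 1)"]) auto
qed

text \<open>The \<open>x\<close> blocks above the root \<open>x\<close> contain \<open>x\<close>
  increasing points beyond \<open>x\<close>, so the last of them is at least
  \<open>2 * x\<close>.\<close>

lemma omega_large_Suc_double:
  assumes "omega_large (Suc n) X" "X \<subseteq> {3..}"
  obtains x z where "x \<in> X" "z \<in> X" "2 * x \<le> z"
proof -
  obtain x where x: "x \<in> X" "blocks (omega_large n) x (X \<inter> {x<..})" using omega_large_SucE[OF assms(1)] .
  have "0 < x" using x(1) assms(2) by force
  then obtain z where "z \<in> X \<inter> {x<..}" "x + x \<le> z" using blocks_ex_ge[OF x(2)] by blast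
  with x(1) that show thesis by auto
qed

text \<open>
  The natural (Hessenberg) sum argument. Colour \<open>c\<close> still has to produce \<open>t c\<close> blocks of exponent
  \<open>n\<close> followed by \<open>s c\<close> blocks of exponent \<open>n + 1\<close>. Whenever colour \<open>c\<close> has met its demand
  \<open>t c\<close>, one more point \<open>y\<close> of that colour opens its next block of exponent \<open>n + 1\<close>, which turns
  \<open>t c\<close> into \<open>y\<close>; the other colours keep their demands and start afresh above \<open>y\<close>. The spare block
  \<open>U1\<close> makes the next point large enough to pay for the new demands.
\<close>

lemma pigeonhole_step:
  fixes C :: "'c set" and f :: "nat \<Rightarrow> 'c"
  assumes C: "finite C"
    and IH: "\<And>X \<sigma>. \<lbrakk>X \<subseteq> {3..}; X \<subseteq> {card C<..}; f ` X \<subseteq> C; \<And>c. c \<in> C \<Longrightarrow> 0 < \<sigma> c;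
        blocks (omega_large (Suc n)) (Suc (\<Sum>c\<in>C. \<sigma> c)) X\<rbrakk> \<Longrightarrow> \<exists>c\<in>C. blocks (omega_large n) (\<sigma> c) (X \<inter> f -` {c})"
  shows "\<lbrakk>V \<subseteq> {3..}; V \<subseteq> {card C<..}; f ` V \<subseteq> C; V \<subseteq> {2 + (\<Sum>c\<in>C. Suc (t c))..};
     blocks (omega_large (Suc (Suc n))) (Suc S) V; S = (\<Sum>c\<in>C. s c)\<rbrakk> \<Longrightarrow>
     \<exists>c\<in>C. \<exists>A B. A \<subseteq> V \<inter> f -` {c} \<and> B \<subseteq> V \<inter> f -` {c} \<and> A \<lless> B \<and>
       blocks (omega_large n) (t c) A \<and> blocks (omega_large (Suc n)) (s c) B"
proof (induction S arbitrary: V t s rule: less_induct)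
  case (less S)
  define T where "T = (\<Sum>c\<in>C. Suc (t c))"
  obtain V0 V1 where V: "V0 \<subseteq> V" "V1 \<subseteq> V" "V0 \<lless> V1" "omega_large (Suc (Suc n)) V0"
      "blocks (omega_large (Suc (Suc n))) S V1"
    using blocks_SucE[OF less.prems(5)] .
  obtain u where u: "u \<in> V0" "blocks (omega_large (Suc n)) u (V0 \<inter> {u<..})" using omega_large_SucE[OF V(4)] .
  have "T + 2 \<le> u" using less.prems(4) u(1) V(1) by (auto simp: T_def)
  \<comment> \<open>\<open>Suc T\<close> blocks pay for asking one block more than
    \<open>t c\<close> of every colour; the last block becomes the spare \<open>U1\<close>.\<close>
  then have "blocks (omega_large (Suc n)) (Suc T + 1) (V0 \<inter> {u<..})"
    by (intro blocks_mono[OF u(2)]) auto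
  then obtain U0 U1 where U: "U0 \<subseteq> V0 \<inter> {u<..}" "U1 \<subseteq> V0 \<inter> {u<..}" "U0 \<lless> U1"
      "blocks (omega_large (Suc n)) (Suc T) U0" "blocks (omega_large (Suc n)) 1 U1"
    by (rule blocks_split)
  have "\<exists>c\<in>C. blocks (omega_large n) (Suc (t c)) (U0 \<inter> f -` {c})"
  proof (rule IH)
    have "U0 \<subseteq> V" using U(1) V(1) by blast
    then show "U0 \<subseteq> {3..}" "U0 \<subseteq> {card C<..}" "f ` U0 \<subseteq> C" using less.prems(1-3) by blast+
  qed (use U(4) in \<open>simp_all add: T_def\<close>)
  then obtain c where c: "c \<in> C" "blocks (omega_large n) (t c + 1) (U0 \<inter> f -` {c})" by auto
  obtain A W where AW: "A \<subseteq> U0 \<inter> f -` {c}" "W \<subseteq> U0 \<inter> f -` {c}" "A \<lless> W"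
      "blocks (omega_large n) (t c) A" "blocks (omega_large n) 1 W"
    using blocks_split[OF c(2)] .
  obtain y where y: "y \<in> W" using AW(5) omega_large_nonempty[of n W] by auto
  show ?case
  proof (cases "s c")
    case 0
    then show ?thesis using c(1) AW U(1) V(1) by (intro bexI[of _ c] exI[of _ A] exI[of _ "{}"])
      (auto simp: sep_def)
  next
    case (Suc sc)
    define t' where "t' = t(c := y)"
    define s' where "s' = s(c := sc)"
    have sum_s: "(\<Sum>c\<in>C. s c) = Suc (\<Sum>c\<in>C. s' c)"
      using C c(1) Suc by (simp add: s'_def sum.remove[of C c])
    have sum_t: "(\<Sum>c\<in>C. Suc (t' c)) \<le> T + y"
      using C c(1) by (simp add: t'_def T_def sum.remove[of C c])
    have "omega_large (Suc n) U1" "U1 \<subseteq> {3..}" using U(2,5) V(1) less.prems(1) by auto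
    then obtain v z where vz: "v \<in> U1" "z \<in> U1" "2 * v \<le> z"
      by (rule omega_large_Suc_double)
    have "y < v" using y AW(2) U(3) vz(1) by (auto simp: sep_def)
    moreover have "T + 2 < v" using vz(1) U(2) \<open>T + 2 \<le> u\<close> by auto
    \<comment> \<open>As \<open>v\<close> exceeds both \<open>y\<close> and \<open>T + 2\<close>,
      its double covers the new total demand, which is at most \<open>T + y\<close>.\<close>
    ultimately have z: "2 + (T + y) \<le> z" using vz(3) by simp
    have V1: "V1 \<subseteq> {2 + (\<Sum>c\<in>C. Suc (t' c))..}"
    proof
      fix w assume "w \<in> V1"
      then have "z < w" using vz(2) U(2) V(3) by (auto simp: sep_def)
      then show "w \<in> {2 + (\<Sum>c\<in>C. Suc (t' c))..}" using z sum_t by simp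
    qed
    have "\<exists>c\<in>C. \<exists>A B. A \<subseteq> V1 \<inter> f -` {c} \<and> B \<subseteq> V1 \<inter> f -` {c} \<and> A \<lless> B \<and>
        blocks (omega_large n) (t' c) A \<and> blocks (omega_large (Suc n)) (s' c) B"
    proof (rule less.IH)
      show "V1 \<subseteq> {3..}" "V1 \<subseteq> {card C<..}" "f ` V1 \<subseteq> C" using V(2) less.prems(1-3) by blast+
    qed (use V(5) V1 less.prems(6) sum_s in simp_all)
    then obtain d A' B' where d: "d \<in> C" "A' \<subseteq> V1 \<inter> f -` {d}" "B' \<subseteq> V1 \<inter> f -` {d}" "A' \<lless> B'"
        "blocks (omega_large n) (t' d) A'" "blocks (omega_large (Suc n)) (s' d) B'"
      by blast
    show ?thesis
    proof (cases "d = c")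
      case False
      \<comment> \<open>A colour other than \<open>c\<close> has unchanged demands, so its blocks
        inside \<open>V1\<close> suffice; \<open>A\<close> and \<open>y\<close> are
        discarded.\<close>
      then show ?thesis using d V(2) unfolding t'_def s'_def
        by (intro bexI[of _ d] exI[of _ A'] exI[of _ B']) auto
    next
      case True
      have yV: "y \<in> V0" "f y = c" using y AW(2) U(1) by auto
      have y_below: "{y} \<lless> A'" "{y} \<lless> B'"
        using yV(1) V(3) d(2,3) by (auto simp: sep_def)
      \<comment> \<open>For \<open>d = c\<close> the demand \<open>t' c = y\<close> provides the
        \<open>y\<close> blocks that the root \<open>y\<close> needs.\<close>
      have "omega_large (Suc n) ({y} \<union> A')"
        using d(5) y_below by (intro omega_large_SucI[of y _ _ A']) (auto simp: t'_def True)
      then have "blocks (omega_large (Suc n)) (1 + sc) (({y} \<union> A') \<union> B')"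
        using d(4,6) y_below by (intro blocks_join) (auto simp: s'_def True sep_def)
      moreover have "A \<lless> ({y} \<union> A') \<union> B'"
      proof -
        have "A \<lless> {y}" using y by (intro sep_subset[OF AW(3)]) auto
        moreover have "A \<lless> V1" using AW(1) U(1) by (intro sep_subset[OF V(3)]) auto
        ultimately show ?thesis using d(2,3) by (auto simp: sep_def)
      qed
      ultimately show ?thesis
        using c(1) AW(1,4) U(1) V(1,2) yV d(2,3) Suc True
        by (intro bexI[of _ c] exI[of _ A] exI[of _ "({y} \<union> A') \<union> B'"]) auto
    qed
  qed
qed

text \<open>One exponent is lost whatever the number of colours, as long as \<open>X\<close> lies
  above \<open>card C\<close>. For exponent 0 this is the weighted pigeonhole on one representative
  per block. Otherwise a point \<open>x\<close> of the first block opens a block of its own colour,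
  and \<open>pigeonhole_step\<close> treats the rest.\<close>

lemma pigeonhole_blocks:
  fixes C :: "'c set" and f :: "nat \<Rightarrow> 'c"
  assumes C: "finite C"
  shows "\<lbrakk>X \<subseteq> {3..}; X \<subseteq> {card C<..}; f ` X \<subseteq> C; \<And>c. c \<in> C \<Longrightarrow> 0 < \<sigma> c;
    blocks (omega_large (Suc n)) (Suc (\<Sum>c\<in>C. \<sigma> c)) X\<rbrakk> \<Longrightarrow> \<exists>c\<in>C. blocks (omega_large n) (\<sigma> c) (X \<inter> f -` {c})"
proof (induction n arbitrary: X \<sigma>)
  case 0
  let ?m = "Suc (\<Sum>c\<in>C. \<sigma> c)"
  obtain r where r: "\<And>i. i < ?m \<Longrightarrow> r i \<in> X" "\<And>i j. i < j \<Longrightarrow> j < ?m \<Longrightarrow> r i < r j"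
    using blocks_transversal[OF 0(5)] by blast
  then obtain c where c: "c \<in> C" "\<sigma> c < card {i\<in>{..<?m}. f (r i) = c}"
    using weighted_pigeonhole[of "{..<?m}" C "\<lambda>i. f (r i)" \<sigma>] C 0(3) by force
  have "inj_on r {..<?m}"
    using r(2) by (intro linorder_inj_onI') fastforce
  then have "card (r ` {i\<in>{..<?m}. f (r i) = c}) = card {i\<in>{..<?m}. f (r i) = c}"
    by (intro card_image) (auto elim: inj_on_subset)
  then have "blocks (omega_large 0) (\<sigma> c) (r ` {i\<in>{..<?m}. f (r i) = c})"
    using c(2) by (intro blocks_of_card) auto
  then have "blocks (omega_large 0) (\<sigma> c) (X \<inter> f -` {c})"
    by (rule blocks_mono) (use r(1) in auto)
  with c(1) show ?case ..
next
  case (Suc n)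
  obtain X0 X1 where X: "X0 \<subseteq> X" "X1 \<subseteq> X" "X0 \<lless> X1" "omega_large (Suc (Suc n)) X0"
      "blocks (omega_large (Suc (Suc n))) (\<Sum>c\<in>C. \<sigma> c) X1"
    using blocks_SucE[OF Suc.prems(5)] .
  have "X0 \<subseteq> {3..}" using X(1) Suc.prems(1) by blast
  with X(4) obtain x z where xz: "x \<in> X0" "z \<in> X0" "2 * x \<le> z"
    by (rule omega_large_Suc_double)
  define c where "c = f x"
  have c: "c \<in> C" using xz(1) X(1) Suc.prems(3) by (auto simp: c_def)
  then obtain m where m: "\<sigma> c = Suc m" using Suc.prems(4) gr0_implies_Suc by blast
  \<comment> \<open>Only the colour of \<open>x\<close> has an open block, which still lacks
    \<open>x\<close> blocks of exponent \<open>n\<close>.\<close>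
  define t where "t = (\<lambda>_. 0)(c := x)"
  define s where "s = \<sigma>(c := m)"
  have sum_s: "(\<Sum>c\<in>C. \<sigma> c) = Suc (\<Sum>c\<in>C. s c)"
    using C c m by (simp add: s_def sum.remove[of C c])
  have sum_t: "(\<Sum>c\<in>C. Suc (t c)) = card C + x"
  proof -
    have "0 < card C" using C c by (auto simp: card_gt_0_iff)
    then show ?thesis using C c by (simp add: t_def sum.remove[of C c])
  qed
  \<comment> \<open>Hence the total demand \<open>card C + x\<close> is less than
    \<open>2 * x\<close>, which \<open>z\<close> reaches before \<open>X1\<close> begins.\<close>
  have "card C < x" using xz(1) X(1) Suc.prems(2) by auto
  then have X1: "X1 \<subseteq> {2 + (\<Sum>c\<in>C. Suc (t c))..}"
    using xz(2,3) X(3) unfolding sum_t by (force simp: sep_def)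
  have "\<exists>c\<in>C. \<exists>A B. A \<subseteq> X1 \<inter> f -` {c} \<and> B \<subseteq> X1 \<inter> f -` {c} \<and> A \<lless> B \<and>
      blocks (omega_large n) (t c) A \<and> blocks (omega_large (Suc n)) (s c) B"
  proof (rule pigeonhole_step[OF C Suc.IH])
    show "X1 \<subseteq> {3..}" "X1 \<subseteq> {card C<..}" "f ` X1 \<subseteq> C" using X(2) Suc.prems(1-3) by blast+
  qed (use X(5) X1 sum_s in simp_all)
  then obtain d A B where d: "d \<in> C" "A \<subseteq> X1 \<inter> f -` {d}" "B \<subseteq> X1 \<inter> f -` {d}" "A \<lless> B"
      "blocks (omega_large n) (t d) A" "blocks (omega_large (Suc n)) (s d) B"
    by blast
  show ?case
  proof (cases "d = c")
    case False
    then show ?thesis using d X(2) unfolding s_def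
      by (intro bexI[of _ d] blocks_mono[OF d(6)]) (auto simp: s_def)
  next
    case True
    have x_below: "{x} \<lless> A" "{x} \<lless> B"
      using xz(1) X(3) d(2,3) by (auto simp: sep_def)
    have "omega_large (Suc n) ({x} \<union> A)"
      using d(5) x_below by (intro omega_large_SucI[of x _ _ A]) (auto simp: t_def True)
    then have "blocks (omega_large (Suc n)) (1 + m) (({x} \<union> A) \<union> B)"
      using d(4,6) x_below by (intro blocks_join) (auto simp: s_def True sep_def)
    then have "blocks (omega_large (Suc n)) (\<sigma> c) (X \<inter> f -` {c})"
      by (rule blocks_mono) (use xz(1) X(1,2) d(2,3) True m in \<open>auto simp: c_def\<close>)
    with c show ?thesis ..
  qed
qed

section \<open>Ramsey's theorem for a single omega\<close>

lemma blocks_ex_exp: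
  "\<lbrakk>blocks (omega_large (Suc n)) (Suc m) X; X \<subseteq> {x<..}; X \<subseteq> {3..}\<rbrakk> \<Longrightarrow> \<exists>z\<in>X. x * 2 ^ Suc m \<le> z"
proof (induction m arbitrary: X x)
  case 0
  then have "omega_large (Suc n) X" by simp
  then obtain a z where "a \<in> X" "z \<in> X" "2 * a \<le> z" using 0(3) by (rule omega_large_Suc_double)
  then show ?case using 0(2) by (intro bexI[of _ z]) auto
next
  case (Suc m)
  obtain U V where UV: "U \<subseteq> X" "V \<subseteq> X" "U \<lless> V" "omega_large (Suc n) U" "blocks (omega_large (Suc n)) (Suc m) V"
    using blocks_SucE[OF Suc.prems(1)] .
  have "U \<subseteq> {3..}" using UV(1) Suc.prems(3) by blast
  with UV(4) obtain a z where az: "a \<in> U" "z \<in> U" "2 * a \<le> z" by (rule omega_large_Suc_double)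
  have "\<exists>w\<in>V. z * 2 ^ Suc m \<le> w"
    using UV(2,3,5) az(2) Suc.prems(3) by (intro Suc.IH) (auto simp: sep_def)
  then obtain w where w: "w \<in> V" "z * 2 ^ Suc m \<le> w" ..
  have "2 * x \<le> z" using az UV(1) Suc.prems(2) by auto
  then have "2 * x * 2 ^ Suc m \<le> z * 2 ^ Suc m" by (rule mult_right_mono) simp
  also note w(2)
  also have "2 * x * 2 ^ Suc m = x * 2 ^ Suc (Suc m)" by simp
  finally have "x * 2 ^ Suc (Suc m) \<le> w" .
  with w(1) UV(2) show ?case by blast
qed

text \<open>Above a root there are at least two blocks. In the first, a root \<open>y >= g\<close>
  is followed by \<open>y\<close> blocks, each of which doubles, so it passes
  \<open>g * 2 ^ g\<close>; the second lies beyond it.\<close>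

lemma omega_large_jump:
  assumes "omega_large (Suc (Suc (Suc n))) G" "G \<subseteq> {3..}" "G \<subseteq> {g..}"
  obtains G' where "G' \<subseteq> G" "omega_large (Suc (Suc n)) G'" "G' \<subseteq> {g * 2 ^ g<..}"
proof -
  obtain x where x: "x \<in> G" "blocks (omega_large (Suc (Suc n))) x (G \<inter> {x<..})" using omega_large_SucE[OF assms(1)] .
  have "3 \<le> x" using x(1) assms(2) by auto
  then have "blocks (omega_large (Suc (Suc n))) (Suc 1) (G \<inter> {x<..})" by (intro blocks_mono[OF x(2)]) auto
  then obtain U V where UV: "U \<subseteq> G \<inter> {x<..}" "V \<subseteq> G \<inter> {x<..}" "U \<lless> V"
      "omega_large (Suc (Suc n)) U" "blocks (omega_large (Suc (Suc n))) 1 V"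
    by (rule blocks_SucE)
  obtain y where y: "y \<in> U" "blocks (omega_large (Suc n)) y (U \<inter> {y<..})" using omega_large_SucE[OF UV(4)] .
  have "y \<noteq> 0" using y(1) UV(1) by auto
  then obtain y' where y': "y = Suc y'" using not0_implies_Suc by blast
  have "\<exists>z\<in>U \<inter> {y<..}. y * 2 ^ Suc y' \<le> z"
    using y UV(1) assms(2) y' by (intro blocks_ex_exp) auto
  then obtain z where z: "z \<in> U" "y * 2 ^ y \<le> z" by (auto simp: y')
  have "g \<le> y" using y(1) UV(1) assms(3) by auto
  then have "g * 2 ^ g \<le> y * 2 ^ y" by (intro mult_mono) auto
  with z(2) have "g * 2 ^ g \<le> z" by (rule order_trans[rotated])
  then have "V \<subseteq> {g * 2 ^ g<..}" using sepD[OF UV(3) z(1)] by (fastforce intro: le_less_trans)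
  with UV(2,5) show thesis by (intro that[of V]) auto
qed

text \<open>The three exponents pay for a jump past \<open>card C\<close>, for opening
  \<open>card C + 1\<close> blocks above a root, and for the pigeonhole. The bound
  \<open>2 ^ g\<close> allows subsets of \<open>{..<g}\<close> as colours, that is, vectors of pair
  colours.\<close>

lemma omega_large_pigeonhole:
  fixes f :: "nat \<Rightarrow> 'c"
  assumes G: "omega_large (n + 3) G" "G \<subseteq> {3..}" "G \<subseteq> {g..}" "0 < g"
    and C: "finite C" "card C \<le> 2 ^ g" "f ` G \<subseteq> C"
  obtains G' c where "G' \<subseteq> G" "omega_large n G'" "\<forall>x\<in>G'. f x = c"
proof -
  have "omega_large (Suc (Suc (Suc n))) G" using G(1) by (simp add: numeral_3_eq_3)
  then obtain H where H: "H \<subseteq> G" "omega_large (Suc (Suc n)) H" "H \<subseteq> {g * 2 ^ g<..}"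
    using G(2,3) by (rule omega_large_jump)
  have "card C \<le> g * 2 ^ g" using G(4) by (intro order_trans[OF C(2)]) simp
  then have H': "H \<subseteq> {card C<..}" using H(3) by (force intro: le_less_trans)
  obtain x where x: "x \<in> H" "blocks (omega_large (Suc n)) x (H \<inter> {x<..})" using omega_large_SucE[OF H(2)] .
  have "card C < x" using x(1) H' by auto
  then have "blocks (omega_large (Suc n)) (Suc (\<Sum>c\<in>C. 1)) (H \<inter> {x<..})"
    by (intro blocks_mono[OF x(2)]) auto
  then have "\<exists>c\<in>C. blocks (omega_large n) 1 ((H \<inter> {x<..}) \<inter> f -` {c})"
    using H(1) H' G(2) C(3) by (intro pigeonhole_blocks[OF C(1)]) blast+
  then obtain c where "omega_large n ((H \<inter> {x<..}) \<inter> f -` {c})" by auto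
  then show thesis using H(1) by (intro that[of "(H \<inter> {x<..}) \<inter> f -` {c}" c]) auto
qed

lemma blocks_card:
  assumes "blocks (omega_large n) m X" "finite X"
  shows "m \<le> card X"
proof -
  obtain r where r: "\<And>i. i < m \<Longrightarrow> r i \<in> X" "\<And>i j. i < j \<Longrightarrow> j < m \<Longrightarrow> r i < r j"
    using blocks_transversal[OF assms(1)] by blast
  have "inj_on r {..<m}" using r(2) by (intro linorder_inj_onI') fastforce
  moreover have "r ` {..<m} \<subseteq> X" using r(1) by blast
  ultimately show ?thesis using card_inj_on_le[OF _ _ assms(2)] by fastforce
qed

text \<open>Two jumps lead past \<open>2 ^ g\<close> and then past
  \<open>2 ^ g * 2 ^ 2 ^ g >= 4 ^ g\<close>; a root \<open>x\<close> found there is followed by at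
  least \<open>x\<close> points.\<close>

lemma omega_large_4_card:
  assumes "omega_large 4 D" "D \<subseteq> {3..}" "D \<subseteq> {g..}" "finite D"
  shows "4 ^ g \<le> card D"
proof -
  have "omega_large (Suc (Suc (Suc 1))) D" using assms(1) by (simp add: eval_nat_numeral)
  then obtain D1 where D1: "D1 \<subseteq> D" "omega_large (Suc (Suc 1)) D1" "D1 \<subseteq> {g * 2 ^ g<..}"
    using assms(2,3) by (rule omega_large_jump)
  have D1_ge: "D1 \<subseteq> {2 ^ g..}"
  proof (cases g)
    case 0
    then show ?thesis using D1(1) assms(2) by fastforce
  next
    case (Suc k)
    then have "2 ^ g \<le> g * 2 ^ g" by simp
    moreover have "g * 2 ^ g \<le> w" if "w \<in> D1" for w using D1(3) that by (auto intro: less_imp_le)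
    ultimately show ?thesis by (meson atLeast_iff order_trans subsetI)
  qed
  have "omega_large (Suc (Suc (Suc 0))) D1" using D1(2) by simp
  moreover have "D1 \<subseteq> {3..}" using D1(1) assms(2) by blast
  ultimately obtain D2 where D2: "D2 \<subseteq> D1" "omega_large (Suc (Suc 0)) D2" "D2 \<subseteq> {2 ^ g * 2 ^ 2 ^ g<..}"
    using D1_ge by (rule omega_large_jump)
  obtain x where x: "x \<in> D2" "blocks (omega_large (Suc 0)) x (D2 \<inter> {x<..})" using omega_large_SucE[OF D2(2)] .
  have "(4::nat) ^ g = 2 ^ g * 2 ^ g" by (simp add: power_mult_distrib[symmetric])
  also have "\<dots> \<le> 2 ^ g * 2 ^ 2 ^ g"
    by (intro mult_left_mono power_increasing) (auto simp: less_imp_le)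
  also have "\<dots> \<le> x" using x(1) D2(3) by auto
  also have "x \<le> card (D2 \<inter> {x<..})"
    using blocks_card[OF x(2)] finite_subset[of D2 D] D1(1) D2(1) assms(4) by blast
  also have "\<dots> \<le> card D" using D1(1) D2(1) assms(4) by (intro card_mono) auto
  finally show ?thesis .
qed

section \<open>Finite Ramsey theorem and homogeneous omega-large sets\<close>

definition monochromatic :: "bool \<Rightarrow> (nat \<Rightarrow> nat \<Rightarrow> bool) \<Rightarrow> nat set \<Rightarrow> bool" where
  "monochromatic e P H \<longleftrightarrow> (\<forall>x\<in>H. \<forall>y\<in>H. x < y \<longrightarrow> P x y = e)"

lemma monochromatic_insert:
  "monochromatic e P H \<Longrightarrow> (\<And>y. y \<in> H \<Longrightarrow> x < y \<and> P x y = e) \<Longrightarrow> monochromatic e P (insert x H)"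
  unfolding monochromatic_def by (metis insert_iff not_less_iff_gr_or_eq)

text \<open>At least \<open>2 ^ m\<close> of the other points are joined to the least point in one
  colour \<open>e\<close>. Recurse into them with the target for \<open>e\<close> lowered by one:
  the least point extends any set of colour \<open>e\<close>. The targets depend on the colour
  because \<open>ramsey_omega\<close> needs different sizes.\<close>

lemma finite_ramsey:
  fixes d :: "bool \<Rightarrow> nat"
  assumes "finite S" "2 ^ (d True + d False) \<le> card S"
  shows "\<exists>e H. H \<subseteq> S \<and> card H = d e \<and> monochromatic e Q H"
  using assms
proof (induction "d True + d False" arbitrary: d S)
  case 0
  then show ?case by (intro exI[of _ True] exI[of _ "{}"]) (auto simp: monochromatic_def)
next
  case (Suc m)
  show ?case
  proof (cases "\<exists>e. d e = 0")
    case True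
    then obtain e where "d e = 0" ..
    then show ?thesis by (intro exI[of _ e] exI[of _ "{}"]) (auto simp: monochromatic_def)
  next
    case False
    then have pos: "0 < d e" for e by auto
    have ne: "S \<noteq> {}" using Suc.prems(2) by auto
    define x where "x = Min S"
    have x: "x \<in> S" using ne Suc.prems(1) by (simp add: x_def)
    define N where "N e = {y\<in>S - {x}. Q x y = e}" for e
    have N: "N e \<subseteq> S" "finite (N e)" "\<And>y. y \<in> N e \<Longrightarrow> x < y \<and> Q x y = e" for e
      using Suc.prems(1) by (auto simp: N_def x_def order_less_le)
    have "S - {x} = N True \<union> N False" by (auto simp: N_def)
    then have "card (S - {x}) \<le> card (N True) + card (N False)" by (metis card_Un_le)
    moreover have "(2::nat) ^ (d True + d False) = 2 ^ m + 2 ^ m" using Suc.hyps(2)[symmetric] by simp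
    ultimately have "2 ^ m \<le> card (N True) \<or> 2 ^ m \<le> card (N False)"
      using x Suc.prems by simp linarith
    then obtain e where e: "2 ^ m \<le> card (N e)" by blast
    define d' where "d' = d(e := d e - 1)"
    have m: "m = d' True + d' False"
      using Suc.hyps(2) pos[of e] by (cases e) (auto simp: d'_def)
    obtain c H where H: "H \<subseteq> N e" "card H = d' c" "monochromatic c Q H"
      using Suc.hyps(1)[OF m N(2), of e] e m by auto
    show ?thesis
    proof (cases "c = e")
      case True
      have "x \<notin> H" using H(1) by (auto simp: N_def)
      then have "card (insert x H) = d e"
        using H(1,2) N(2)[of e] finite_subset[of H "N e"] pos[of e] True by (simp add: d'_def)
      moreover have "monochromatic e Q (insert x H)"
        using H N(3)[of _ e] True by (intro monochromatic_insert) auto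
      ultimately show ?thesis using x H(1) N(1)[of e]
        by (intro exI[of _ e] exI[of _ "insert x H"]) auto
    next
      case False
      then show ?thesis using H N(1)[of e]
        by (intro exI[of _ c] exI[of _ H]) (auto simp: d'_def)
    qed
  qed
qed

lemma omega_large_1_insert: "finite R \<Longrightarrow> x \<le> card R \<Longrightarrow> {x} \<lless> R \<Longrightarrow> omega_large 1 (insert x R)"
  using omega_large_SucI[of x "insert x R" 0 R] blocks_of_card[of R x] by auto

lemma sum_power4_less: "(\<Sum>r<g. 4 ^ r) < (4::nat) ^ g"
  by (induction g) auto

text \<open>The exponent 9 is one for the root \<open>x\<close>, three for making \<open>Q x\<close>
  constant on \<open>N\<close>, and five so that \<open>N\<close> still contains \<open>x\<close>
  blocks of exponent 4 for the greedy choice.\<close>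

lemma ramsey_omega:
  fixes Q :: "nat \<Rightarrow> nat \<Rightarrow> bool"
  assumes M: "finite M" "M \<subseteq> {3..}" "omega_large 9 M"
  obtains e H where "H \<subseteq> M" "omega_large 1 H" "monochromatic e Q H"
proof -
  have "omega_large (Suc 8) M" using M(3) by simp
  then obtain x where x: "x \<in> M" "blocks (omega_large 8) x (M \<inter> {x<..})" by (rule omega_large_SucE)
  have "3 \<le> x" using x(1) M(2) by auto
  then have "blocks (omega_large 8) 1 (M \<inter> {x<..})" by (intro blocks_mono[OF x(2)]) auto
  then have "omega_large (5 + 3) (M \<inter> {x<..})" by simp
  moreover have "M \<inter> {x<..} \<subseteq> {3..}" using M(2) by auto
  ultimately obtain N e where N: "N \<subseteq> M \<inter> {x<..}" "omega_large 5 N" "\<forall>y\<in>N. Q x y = e"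
    by (rule omega_large_pigeonhole[where g = 3 and C = UNIV and f = "Q x"]) (use M(2) in auto)
  have finN: "finite N" and N3: "N \<subseteq> {3..}" using N(1) M(1,2) finite_subset by auto
  \<comment> \<open>If some \<open>s\<close> has many bad points, the finite Ramsey theorem inside \<open>bad s\<close> gives a set that can be
    extended by \<open>x\<close> or by \<open>s\<close>. Otherwise a greedy choice avoiding all bad points works.\<close>
  define bad where "bad s = {y\<in>N. s < y \<and> Q s y \<noteq> e}" for s
  show thesis
  proof (cases "\<exists>s\<in>N. 2 ^ (x + s) \<le> card (bad s)")
    case True
    then obtain s where s: "s \<in> N" "2 ^ (x + s) \<le> card (bad s)" ..
    \<comment> \<open>Colour \<open>e\<close> is completed by the root \<open>x\<close> and needs
      \<open>x\<close> points; the other colour is completed by \<open>s\<close> and needs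
      \<open>s\<close> points.\<close>
    define d where "d c = (if c = e then x else s)" for c
    have "d True + d False = x + s" by (cases e) (auto simp: d_def)
    moreover have "finite (bad s)" using finN by (simp add: bad_def)
    ultimately obtain c H where H: "H \<subseteq> bad s" "card H = d c" "monochromatic c Q H"
      using finite_ramsey[of "bad s" d Q] s(2) by auto
    have finH: "finite H" using H(1) \<open>finite (bad s)\<close> finite_subset by blast
    show thesis
    proof (cases "c = e")
      case True
      have *: "x < y \<and> Q x y = e" if "y \<in> H" for y
        using that H(1) N(1,3) by (auto simp: bad_def)
      show thesis
      proof
        show "insert x H \<subseteq> M" using H(1) N(1) x(1) by (auto simp: bad_def)
        show "omega_large 1 (insert x H)"
          using * H(2) True finH by (intro omega_large_1_insert) (auto simp: d_def sep_def)
        show "monochromatic e Q (insert x H)" using * H(3) True by (intro monochromatic_insert) auto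
      qed
    next
      case False
      have *: "s < y \<and> Q s y = c" if "y \<in> H" for y
        using that H(1) False by (auto simp: bad_def)
      show thesis
      proof
        show "insert s H \<subseteq> M" using H(1) N(1) s(1) by (auto simp: bad_def)
        show "omega_large 1 (insert s H)"
          using * H(2) False finH by (intro omega_large_1_insert) (auto simp: d_def sep_def)
        show "monochromatic c Q (insert s H)" using * H(3) by (intro monochromatic_insert) auto
      qed
    qed
  next
    case False
    have greedy: "\<exists>R\<subseteq>Y. card R = t \<and> monochromatic e Q R" if "blocks (omega_large 4) t Y" "Y \<subseteq> N" for t Y
      using that
    proof (induction t arbitrary: Y)
      case 0
      then show ?case by (intro exI[of _ "{}"]) (auto simp: monochromatic_def)
    next
      case (Suc t)
      have "blocks (omega_large 4) (t + 1) Y" using Suc.prems(1) by simp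
      then obtain U V where UV: "U \<subseteq> Y" "V \<subseteq> Y" "U \<lless> V" "blocks (omega_large 4) t U" "blocks (omega_large 4) 1 V"
        by (rule blocks_split)
      obtain R where R: "R \<subseteq> U" "card R = t" "monochromatic e Q R"
        using Suc.IH[OF UV(4)] UV(1) Suc.prems(2) by blast
      have V: "omega_large 4 V" using UV(5) by simp
      have VN: "V \<subseteq> N" and RN: "R \<subseteq> N" using UV(1,2) R(1) Suc.prems(2) by auto
      have finV: "finite V" and finR: "finite R" using VN RN finN finite_subset by auto
      define g where "g = Min V"
      have g: "g \<in> V" "V \<subseteq> {g..}" using finV omega_large_nonempty[OF V] by (auto simp: g_def)
      \<comment> \<open>All earlier choices lie below \<open>g = Min V\<close>, and each excludes at
        most \<open>4 ^ r\<close> points since \<open>x < r\<close>. The geometric sum stays below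
        \<open>4 ^ g\<close>, so \<open>V\<close> retains an admissible point.\<close>
      have "card (\<Union>r\<in>R. bad r) \<le> (\<Sum>r\<in>R. card (bad r))" using finR by (rule card_UN_le)
      also have "\<dots> \<le> (\<Sum>r\<in>R. 4 ^ r)"
      proof (rule sum_mono)
        fix r assume "r \<in> R"
        then have "r \<in> N" using RN by blast
        then have "x < r" "card (bad r) \<le> 2 ^ (x + r)" using N(1) False by auto
        moreover have "(2::nat) ^ (x + r) \<le> 2 ^ (2 * r)"
          using \<open>x < r\<close> by (intro power_increasing) auto
        ultimately show "card (bad r) \<le> 4 ^ r" by (simp add: power_mult)
      qed
      also have "\<dots> \<le> (\<Sum>r<g. 4 ^ r)"
        using R(1) UV(3) g(1) by (intro sum_mono2) (auto simp: sep_def)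
      also have "\<dots> < 4 ^ g" by (rule sum_power4_less)
      also have "\<dots> \<le> card V" using V VN N3 g(2) finV by (intro omega_large_4_card) auto
      finally have "\<not> V \<subseteq> (\<Union>r\<in>R. bad r)"
        using finR finN card_mono[of "\<Union>r\<in>R. bad r" V] by (auto simp: bad_def)
      then obtain s where s: "s \<in> V" "\<And>r. r \<in> R \<Longrightarrow> s \<notin> bad r" by blast
      have R_s: "r < s \<and> Q r s = e" if "r \<in> R" for r
        using that s R(1) UV(3) VN by (force simp: bad_def sep_def)
      then have "s \<notin> R" by blast
      then have "card (insert s R) = Suc t" using finR R(2) by simp
      moreover have "monochromatic e Q (insert s R)"
        using R(3) R_s unfolding monochromatic_def by (metis insert_iff less_asym)
      ultimately show ?case using s(1) UV(1,2) R(1) by (intro exI[of _ "insert s R"]) auto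
    qed
    have "omega_large (Suc 4) N" using N(2) by simp
    then obtain z where z: "z \<in> N" "blocks (omega_large 4) z (N \<inter> {z<..})" by (rule omega_large_SucE)
    have "blocks (omega_large 4) x N" by (rule blocks_mono[OF z(2)]) (use z(1) N(1) in auto)
    then obtain R where R: "R \<subseteq> N" "card R = x" "monochromatic e Q R" using greedy by blast
    have *: "x < y \<and> Q x y = e" if "y \<in> R" for y using that R(1) N(1,3) by auto
    show thesis
    proof
      show "insert x R \<subseteq> M" using R(1) N(1) x(1) by auto
      show "omega_large 1 (insert x R)"
        using * R(1,2) finN finite_subset by (intro omega_large_1_insert) (auto simp: sep_def)
      show "monochromatic e Q (insert x R)" using * R(3) by (intro monochromatic_insert) auto
    qed
  qed
qed

section \<open>Groupings\<close>

definition constant_on_product :: "(nat \<Rightarrow> nat \<Rightarrow> bool) \<Rightarrow> nat set \<Rightarrow> nat set \<Rightarrow> bool" where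
  "constant_on_product P A B \<longleftrightarrow> (\<exists>e. \<forall>x\<in>A. \<forall>y\<in>B. P x y = e)"

lemma constant_on_productI: "(\<And>x y. x \<in> A \<Longrightarrow> y \<in> B \<Longrightarrow> P x y = e) \<Longrightarrow> constant_on_product P A B"
  unfolding constant_on_product_def by (rule exI[of _ e]) simp

lemma constant_on_product_subset: "constant_on_product P A B \<Longrightarrow> A' \<subseteq> A \<Longrightarrow> B' \<subseteq> B \<Longrightarrow> constant_on_product P A' B'"
  unfolding constant_on_product_def subset_iff by (elim exE, rule_tac x=e in exI) simp

text \<open>The family is not indexed: its length is measured on \<open>Max\<close>
  \<F>\<open>. With\<close>omega_large j (Max \<open>\<F>)\<close> added, this is an
  \<open>(omega^k, omega^j)\<close>-grouping.\<close>

definition grouping :: "(nat \<Rightarrow> nat \<Rightarrow> bool) \<Rightarrow> nat \<Rightarrow> nat set \<Rightarrow> nat set set \<Rightarrow> bool" where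
  "grouping P k X \<F> \<longleftrightarrow>
     (\<forall>A\<in>\<F>. A \<subseteq> X \<and> omega_large k A) \<and>
     (\<forall>A\<in>\<F>. \<forall>B\<in>\<F>. A \<noteq> B \<longrightarrow> A \<lless> B \<or> B \<lless> A) \<and>
     (\<forall>A\<in>\<F>. \<forall>B\<in>\<F>. A \<lless> B \<longrightarrow> constant_on_product P A B)"

lemma groupingD:
  assumes "grouping P k X \<F>"
  shows "A \<in> \<F> \<Longrightarrow> A \<subseteq> X" "A \<in> \<F> \<Longrightarrow> omega_large k A"
    "A \<in> \<F> \<Longrightarrow> B \<in> \<F> \<Longrightarrow> A \<noteq> B \<Longrightarrow> A \<lless> B \<or> B \<lless> A"
    "A \<in> \<F> \<Longrightarrow> B \<in> \<F> \<Longrightarrow> A \<lless> B \<Longrightarrow> constant_on_product P A B"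
  using assms unfolding grouping_def by simp_all

text \<open>Distinct blocks are separated, so maxima decide their order; this carries statements
  about the set of maxima back to the blocks.\<close>

lemma grouping_sep_iff:
  assumes "grouping P k X \<F>" "finite X" "A \<in> \<F>" "B \<in> \<F>"
  shows "A \<lless> B \<longleftrightarrow> Max A < Max B"
proof -
  have fin: "finite A" "finite B" and ne: "A \<noteq> {}" "B \<noteq> {}"
    using groupingD(1,2)[OF assms(1)] assms(3,4) finite_subset[OF _ assms(2)] omega_large_nonempty[of k A]
      omega_large_nonempty[of k B] by auto
  have "Max A < Max B" if "A \<lless> B" using that fin ne by (auto simp: sep_def)
  moreover have "\<not> Max A < Max B" if "B \<lless> A"
    using sepD[OF that Max_in[OF fin(2) ne(2)] Max_in[OF fin(1) ne(1)]] by simp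
  ultimately show ?thesis using groupingD(3)[OF assms(1,3,4)] by blast
qed

text \<open>One early block \<open>F0\<close> is bounded by \<open>a\<close>, and more than
  \<open>a\<close> later blocks \<open>F j\<close> survive, which makes the maxima
  \<open>omega\<close>-large. Each later block is thinned twice: first its points become alike for
  everything below it, then they see each representative \<open>r j\<close> in one colour. The nine
  exponents: one to separate \<open>A\<close> from \<open>Y\<close>, one to jump past
  \<open>N\<close>, one to open \<open>N\<close> blocks, and three for each thinning.\<close>

lemma grouping_omega:
  fixes P :: "nat \<Rightarrow> nat \<Rightarrow> bool"
  assumes X: "finite X" "X \<subseteq> {3..}" "omega_large (k + 9) X"
  obtains \<F> where "grouping P k X \<F>" "omega_large 1 (Max ` \<F>)"
proof -
  have "omega_large (Suc (k + 8)) X" using X(3) by (simp add: eval_nat_numeral)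
  then obtain x where x: "x \<in> X" "blocks (omega_large (k + 8)) x (X \<inter> {x<..})" by (rule omega_large_SucE)
  have "3 \<le> x" using x(1) X(2) by auto
  then have "blocks (omega_large (k + 8)) (Suc 1) (X \<inter> {x<..})" by (intro blocks_mono[OF x(2)]) auto
  then obtain A Y where AY: "A \<subseteq> X \<inter> {x<..}" "Y \<subseteq> X \<inter> {x<..}" "A \<lless> Y"
      "omega_large (k + 8) A" "blocks (omega_large (k + 8)) 1 Y"
    by (rule blocks_SucE)
  have finA: "finite A" and A3: "A \<subseteq> {3..}" and AX: "A \<subseteq> X"
    using AY(1) X(1,2) finite_subset by auto
  have Y3: "Y \<subseteq> {3..}" and YX: "Y \<subseteq> X" using AY(2) X(2) by auto
  define a where "a = Max A"
  have a: "a \<in> A" "\<And>y. y \<in> A \<Longrightarrow> y \<le> a" using finA omega_large_nonempty[OF AY(4)] by (auto simp: a_def)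
  \<comment> \<open>There are \<open>2 ^ (a + 1)\<close> colour vectors on \<open>{..a}\<close>, so
    \<open>N\<close> blocks force more than \<open>a\<close> of them to share a vector.\<close>
  define N where "N = (a + 1) * 2 ^ (a + 1)"
  have Y_ge: "Y \<subseteq> {a + 1..}"
    using AY(3) a(1) by (auto simp: sep_def Suc_le_eq)
  have "omega_large (Suc (Suc (Suc (k + 5)))) Y" using AY(5) by (simp add: eval_nat_numeral)
  then obtain Z where Z: "Z \<subseteq> Y" "omega_large (Suc (Suc (k + 5))) Z" "Z \<subseteq> {N<..}"
    unfolding N_def using Y3 Y_ge by (rule omega_large_jump)
  have "omega_large (Suc (k + 6)) Z" using Z(2) by (simp add: eval_nat_numeral)
  then obtain u where u: "u \<in> Z" "blocks (omega_large (k + 6)) u (Z \<inter> {u<..})" by (rule omega_large_SucE)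
  have "blocks (omega_large (k + 6)) N Z" by (rule blocks_mono[OF u(2)]) (use u(1) Z(3) in auto)
  then obtain G where G: "\<And>i. i < N \<Longrightarrow> G i \<subseteq> Z" "\<And>i. i < N \<Longrightarrow> omega_large (k + 6) (G i)"
      "\<And>i j. i < j \<Longrightarrow> j < N \<Longrightarrow> G i \<lless> G j"
    unfolding blocks_def by blast
  have G3: "G i \<subseteq> {3..}" and GN: "G i \<subseteq> {N..}" if "i < N" for i
    using G(1)[OF that] Z(1,3) Y3 by (auto intro: less_imp_le)
  have AG: "A \<lless> G i" if "i < N" for i
    using G(1)[OF that] Z(1) by (intro sep_subset[OF AY(3)]) auto

  \<comment> \<open>Colour \<open>y\<close> by the set of \<open>w\<close> below the least element
    \<open>g\<close> of \<open>G i\<close> with \<open>P w y\<close>: this gives at most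
    \<open>2 ^ g\<close> colours.\<close>
  have "\<exists>H. H \<subseteq> G i \<and> omega_large (k + 3) H \<and> (\<forall>w. {w} \<lless> G i \<longrightarrow> (\<forall>y\<in>H. \<forall>y'\<in>H. P w y = P w y'))"
    if i: "i < N" for i
  proof -
    define g where "g = (LEAST y. y \<in> G i)"
    have g: "g \<in> G i" "G i \<subseteq> {g..}"
      unfolding g_def using omega_large_nonempty[OF G(2)[OF i]] by (auto intro: LeastI Least_le)
    have "omega_large (k + 3 + 3) (G i)" using G(2)[OF i] by (simp add: eval_nat_numeral)
    then obtain H c where H: "H \<subseteq> G i" "omega_large (k + 3) H" "\<forall>y\<in>H. {w\<in>{..<g}. P w y} = c"
    proof (rule omega_large_pigeonhole[OF _ G3[OF i] g(2), where C = "Pow {..<g}" and f = "\<lambda>y. {w\<in>{..<g}. P w y}"])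
      show "0 < g" using g(1) G3[OF i] by force
    qed (auto simp: card_Pow)
    have "P w y = P w y'" if "{w} \<lless> G i" "y \<in> H" "y' \<in> H" for w y y'
    proof -
      have "w < g" using that(1) g(1) by (auto simp: sep_def)
      then have "P w y \<longleftrightarrow> w \<in> c" "P w y' \<longleftrightarrow> w \<in> c" using H(3) that(2,3) by blast+
      then show ?thesis by simp
    qed
    with H(1,2) show ?thesis by blast
  qed
  then obtain H where H: "\<And>i. i < N \<Longrightarrow> H i \<subseteq> G i" "\<And>i. i < N \<Longrightarrow> omega_large (k + 3) (H i)"
      "\<And>i w y y'. i < N \<Longrightarrow> {w} \<lless> G i \<Longrightarrow> y \<in> H i \<Longrightarrow> y' \<in> H i \<Longrightarrow> P w y = P w y'"
    by metis
  define r where "r i = (SOME y. y \<in> H i)" for i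
  have r: "r i \<in> H i" if "i < N" for i
    unfolding r_def using omega_large_nonempty[OF H(2)[OF that]] by (simp add: some_in_eq)

  have "0 < N" by (simp add: N_def)
  \<comment> \<open>Now the colour of \<open>w\<close> is its vector towards all \<open>N\<close>
    representatives; \<open>2 ^ N\<close> colours are affordable because the blocks lie in
    \<open>{N..}\<close>.\<close>
  have "\<exists>F. F \<subseteq> H i \<and> omega_large k F \<and> (\<forall>j<N. \<exists>e. \<forall>w\<in>F. P w (r j) = e)" if i: "i < N" for i
  proof -
    have "H i \<subseteq> {3..}" "H i \<subseteq> {N..}" using H(1)[OF i] G3[OF i] GN[OF i] by blast+
    with H(2)[OF i] obtain F c where F: "F \<subseteq> H i" "omega_large k F" "\<forall>w\<in>F. {j\<in>{..<N}. P w (r j)} = c"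
      by (rule omega_large_pigeonhole[OF _ _ _ \<open>0 < N\<close>, where C = "Pow {..<N}" and
            f = "\<lambda>w. {j\<in>{..<N}. P w (r j)}"]) (auto simp: card_Pow)
    have "P w (r j) \<longleftrightarrow> j \<in> c" if "j < N" "w \<in> F" for w j using F(3) that by blast
    then have "\<exists>e. \<forall>w\<in>F. P w (r j) = e" if "j < N" for j using that by (intro exI[of _ "j \<in> c"]) auto
    with F(1,2) show ?thesis by blast
  qed
  then obtain F where F: "\<And>i. i < N \<Longrightarrow> F i \<subseteq> H i" "\<And>i. i < N \<Longrightarrow> omega_large k (F i)"
      "\<And>i j. i < N \<Longrightarrow> j < N \<Longrightarrow> \<exists>e. \<forall>w\<in>F i. P w (r j) = e"
    by metis
  have FG: "F i \<subseteq> G i" if "i < N" for i using F(1) H(1) that by blast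
  have Pr: "P w y = P w (r j)" if "j < N" "{w} \<lless> G j" "y \<in> F j" for w y j
    using H(3)[OF that(1,2)] F(1)[OF that(1)] r[OF that(1)] that(3) by blast

  \<comment> \<open>The set \<open>A\<close> cannot be thinned once for each of the \<open>N\<close> blocks, so first keep only blocks
    \<open>F j\<close> that all induce the same colour vector on \<open>A\<close>.\<close>
  define v where "v j = {w\<in>A. P w (r j)}" for j
  have v: "v ` {..<N} \<subseteq> Pow {..a}" using a(2) by (auto simp: v_def)
  have "(\<Sum>c\<in>Pow {..a}. a) < card {..<N}" by (simp add: card_Pow N_def)
  then obtain c where c: "a < card {i\<in>{..<N}. v i = c}"
    using weighted_pigeonhole[OF _ _ v, of "\<lambda>_. a"] by auto
  define J where "J = {i\<in>{..<N}. v i = c}"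
  have J: "J \<subseteq> {..<N}" "finite J" "a < card J" using c by (auto simp: J_def)

  have "omega_large (k + 5 + 3) A" using AY(4) by (simp add: eval_nat_numeral)
  then obtain F0 e0 where F0: "F0 \<subseteq> A" "omega_large (k + 5) F0" "\<forall>w\<in>F0. (w \<in> c) = e0"
    using A3 by (rule omega_large_pigeonhole[where g = 3 and C = UNIV and f = "\<lambda>w. w \<in> c"]) (use A3 in auto)
  have F0k: "omega_large k F0" using omega_large_antimono[OF F0(2)] F0(1) A3 by auto

  have F0F: "F0 \<lless> F j" if "j \<in> J" for j
    using that F0(1) FG J(1) by (intro sep_subset[OF AG]) auto
  have FF: "F i \<lless> F j" if "i < j" "j \<in> J" for i j
  proof -
    have "j < N" "i < N" using that J(1) by auto
    then show ?thesis using FG that(1) by (intro sep_subset[OF G(3)])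
  qed
  have ne: "F0 \<noteq> {}" "\<And>j. j \<in> J \<Longrightarrow> F j \<noteq> {}" using F0k F(2) J(1) omega_large_nonempty by blast+
  have not_sep: False if "U \<lless> V" "V \<lless> U" "U \<noteq> {}" "V \<noteq> {}" for U V
    using that by (meson all_not_in_conv less_asym sepD)
  have col0: "constant_on_product P F0 (F j)" if j: "j \<in> J" for j
  proof -
    have "P w y = e0" if "w \<in> F0" "y \<in> F j" for w y
    proof -
      have "w \<in> A" "j < N" using that(1) F0(1) j J(1) by auto
      then have "P w y = P w (r j)" using that(2) AG[of j] by (intro Pr) (auto simp: sep_def)
      also have "\<dots> = (w \<in> v j)" using \<open>w \<in> A\<close> by (simp add: v_def)
      also have "v j = c" using j by (simp add: J_def)
      finally show ?thesis using F0(3) that(1) by simp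
    qed
    then show ?thesis by (rule constant_on_productI)
  qed
  have col: "constant_on_product P (F i) (F j)" if ij: "i \<in> J" "j \<in> J" "i < j" for i j
  proof -
    have lt: "i < N" "j < N" using ij J(1) by auto
    obtain e where e: "\<And>w. w \<in> F i \<Longrightarrow> P w (r j) = e" using F(3)[OF lt] by blast
    have "P w y = e" if "w \<in> F i" "y \<in> F j" for w y
    proof -
      have "{w} \<lless> G j" using that(1) FG[OF lt(1)] by (intro sep_subset[OF G(3)[OF ij(3) lt(2)]]) auto
      then show ?thesis using Pr[OF lt(2) _ that(2)] e[OF that(1)] by simp
    qed
    then show ?thesis by (rule constant_on_productI)
  qed
  define \<F> where "\<F> = insert F0 (F ` J)"
  have "grouping P k X \<F>"
    unfolding grouping_def
  proof (intro conjI ballI impI)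
    fix B assume B: "B \<in> \<F>"
    show "B \<subseteq> X"
      using B F0(1) AX FG J(1) G(1) Z(1) YX unfolding \<F>_def by blast
    show "omega_large k B" using B F0k F(2) J(1) unfolding \<F>_def by blast
    fix D assume D: "D \<in> \<F>"
    show "B \<lless> D \<or> D \<lless> B" if "B \<noteq> D"
      using B D that F0F FF unfolding \<F>_def by (auto; metis linorder_neqE_nat)
    show "constant_on_product P B D" if BD: "B \<lless> D"
    proof -
      have BD_ne: "B \<noteq> {}" "D \<noteq> {}" using B D ne unfolding \<F>_def by auto
      have "B \<noteq> D" using not_sep[of B B] BD_ne BD by auto
      consider "B = F0" "D = F0" | j where "j \<in> J" "B = F0" "D = F j"
        | i where "i \<in> J" "B = F i" "D = F0" | i j where "i \<in> J" "j \<in> J" "B = F i" "D = F j"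
        using B D unfolding \<F>_def by blast
      then show ?thesis
      proof cases
        case 1
        then show ?thesis using \<open>B \<noteq> D\<close> by simp
      next
        case 2
        then show ?thesis using col0 by simp
      next
        case 3
        then show ?thesis using not_sep[OF BD] F0F BD_ne by blast
      next
        case 4
        have "i < j"
        proof (rule ccontr)
          assume "\<not> i < j"
          with 4 \<open>B \<noteq> D\<close> have "j < i" by (cases "i = j") auto
          then show False using 4 not_sep[OF BD] FF BD_ne by blast
        qed
        with 4 col show ?thesis by simp
      qed
    qed
  qed
  moreover have "omega_large 1 (Max ` \<F>)"
  proof -
    have "finite B" if "B \<in> \<F>" for B
      using groupingD(1)[OF \<open>grouping P k X \<F>\<close> that] X(1) by (rule finite_subset)
    then have fin: "finite F0" "\<And>j. j \<in> J \<Longrightarrow> finite (F j)" by (auto simp: \<F>_def)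
    have lt: "Max (F i) < Max (F j)" if "i < j" "i \<in> J" "j \<in> J" for i j
      using FF[OF that(1,3)] fin(2)[OF that(2)] fin(2)[OF that(3)] ne(2)[OF that(2)] ne(2)[OF that(3)]
      by (auto simp: sep_def)
    have lt0: "Max F0 < Max (F j)" if "j \<in> J" for j
      using F0F[OF that] fin(1) fin(2)[OF that] ne(1) ne(2)[OF that] by (auto simp: sep_def)
    have "inj_on (\<lambda>j. Max (F j)) J"
      by (intro linorder_inj_onI') (use lt in fastforce)
    then have "card ((\<lambda>j. Max (F j)) ` J) = card J" by (rule card_image)
    \<comment> \<open>With \<open>a < card J\<close> this leaves at least \<open>Max F0\<close>
      later maxima above the root \<open>Max F0\<close>.\<close>
    moreover have "Max F0 \<le> a" using fin(1) ne(1) F0(1) a(2) by auto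
    ultimately have "omega_large 1 (insert (Max F0) ((\<lambda>j. Max (F j)) ` J))"
      using J(2,3) lt0 by (intro omega_large_1_insert) (auto simp: sep_def)
    then show ?thesis by (simp add: \<F>_def image_image)
  qed
  ultimately show thesis by (rule that)
qed

text \<open>Each further factor \<open>omega\<close> costs nine exponents: take a grouping with
  \<open>omega\<close>-large maxima, then groupings inside its blocks by induction, and unite them.
  Pairs from different outer blocks inherit their constant colour from the outer grouping.\<close>

lemma grouping_omega_power:
  fixes P :: "nat \<Rightarrow> nat \<Rightarrow> bool"
  shows "\<lbrakk>finite X; X \<subseteq> {3..}; omega_large (k + 9 * j) X\<rbrakk> \<Longrightarrow> \<exists>\<F>. grouping P k X \<F> \<and> omega_large j (Max ` \<F>)"
proof (induction j arbitrary: X)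
  case 0
  have "\<not> X \<lless> X" using 0(3) omega_large_nonempty[of k X] by (auto simp: sep_def)
  then show ?case using 0 by (intro exI[of _ "{X}"]) (auto simp: grouping_def)
next
  case (Suc j)
  have "omega_large (k + 9 * j + 9) X" using Suc.prems(3) by (simp add: add.commute add.left_commute)
  then obtain \<G> where \<G>: "grouping P (k + 9 * j) X \<G>" "omega_large 1 (Max ` \<G>)"
    using grouping_omega[OF Suc.prems(1,2)] by blast
  note gr = groupingD[OF \<G>(1)]
  have fin: "finite A" if "A \<in> \<G>" for A using gr(1)[OF that] Suc.prems(1) finite_subset by blast
  have "\<exists>\<H>. grouping P k A \<H> \<and> omega_large j (Max ` \<H>)" if "A \<in> \<G>" for A
    using gr(1,2)[OF that] fin[OF that] Suc.prems(2) by (intro Suc.IH) auto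
  then obtain \<H> where \<H>: "\<And>A. A \<in> \<G> \<Longrightarrow> grouping P k A (\<H> A)" "\<And>A. A \<in> \<G> \<Longrightarrow> omega_large j (Max ` \<H> A)"
    by metis
  define \<F> where "\<F> = (\<Union>A\<in>\<G>. \<H> A)"
  have sub: "B \<subseteq> A" if "A \<in> \<G>" "B \<in> \<H> A" for A B using groupingD(1)[OF \<H>(1)] that by blast
  have Lk: "omega_large k B" if "A \<in> \<G>" "B \<in> \<H> A" for A B using groupingD(2)[OF \<H>(1)] that by blast
  have Max_in_A: "Max B \<in> A" if "A \<in> \<G>" "B \<in> \<H> A" for A B
    using sub[OF that] Lk[OF that] fin[OF that(1)] omega_large_nonempty Max_in finite_subset by (metis subsetD)
  have "grouping P k X \<F>"
    unfolding grouping_def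
  proof (intro conjI ballI impI)
    fix B assume "B \<in> \<F>"
    then obtain A where A: "A \<in> \<G>" "B \<in> \<H> A" by (auto simp: \<F>_def)
    show "B \<subseteq> X" using gr(1) sub A by blast
    show "omega_large k B" using Lk A .
    fix B' assume "B' \<in> \<F>"
    then obtain A' where A': "A' \<in> \<G>" "B' \<in> \<H> A'" by (auto simp: \<F>_def)
    show "B \<lless> B' \<or> B' \<lless> B" if "B \<noteq> B'"
    proof (cases "A = A'")
      case True
      then show ?thesis using groupingD(3)[OF \<H>(1)] A A' that by blast
    next
      case False
      then have "A \<lless> A' \<or> A' \<lless> A" using gr(3) A A' by blast
      then show ?thesis using sub[OF A] sub[OF A'] sep_subset by blast
    qed
    show "constant_on_product P B B'" if "B \<lless> B'"
    proof (cases "A = A'")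
      case True
      then show ?thesis using groupingD(4)[OF \<H>(1)] A A' that by blast
    next
      case False
      have "B \<noteq> {}" "B' \<noteq> {}" using Lk A A' omega_large_nonempty by blast+
      then obtain b b' where b: "b \<in> B" "b' \<in> B'" by blast
      have "b < b'" using sepD[OF that b] .
      moreover have "b \<in> A" "b' \<in> A'" using b sub[OF A] sub[OF A'] by blast+
      ultimately have "\<not> A' \<lless> A" using sepD[of A' A b' b] by auto
      then have "A \<lless> A'" using gr(3) A A' False by blast
      then have "constant_on_product P A A'" using gr(4) A A' by blast
      then show ?thesis using sub[OF A] sub[OF A'] by (rule constant_on_product_subset)
    qed
  qed
  moreover have "omega_large (Suc j) (Max ` \<F>)"
  proof -
    have "omega_large (Suc 0) (Max ` \<G>)" using \<G>(2) by simp
    then obtain p where p: "p \<in> Max ` \<G>" "blocks (omega_large 0) p (Max ` \<G> \<inter> {p<..})" by (rule omega_large_SucE)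
    obtain A where A: "A \<in> \<G>" "p = Max A" using p(1) by blast
    obtain q where q: "\<And>i. i < p \<Longrightarrow> q i \<in> Max ` \<G> \<inter> {p<..}" "\<And>i j. i < j \<Longrightarrow> j < p \<Longrightarrow> q i < q j"
      using blocks_transversal[OF p(2)] by blast
    have "\<exists>D\<in>\<G>. Max D = q i" if "i < p" for i using q(1)[OF that] by auto
    then obtain D where D: "\<And>i. i < p \<Longrightarrow> D i \<in> \<G>" "\<And>i. i < p \<Longrightarrow> Max (D i) = q i" by metis
    obtain B where B: "B \<in> \<H> A" using omega_large_nonempty[OF \<H>(2)[OF A(1)]] by auto
    have xA: "Max B \<in> A" using Max_in_A A(1) B .
    \<comment> \<open>The outer maxima supply \<open>p\<close> later blocks, which is enough for the
      smaller root \<open>Max B\<close>.\<close>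
    then have xp: "Max B \<le> p" using fin[OF A(1)] A(2) by simp
    have AD: "A \<lless> D i" if "i < p" for i
      using grouping_sep_iff[OF \<G>(1) Suc.prems(1) A(1) D(1)[OF that]] q(1)[OF that] D(2)[OF that] A(2)
      by simp
    have DD: "D i \<lless> D j" if "i < j" "j < p" for i j
      using grouping_sep_iff[OF \<G>(1) Suc.prems(1) D(1) D(1)] q(2)[OF that] D(2) that by simp
    have sub_D: "Max ` \<H> (D i) \<subseteq> D i" if "i < p" for i using Max_in_A D(1)[OF that] by blast
    have "blocks (omega_large j) p (\<Union>i<p. Max ` \<H> (D i))"
      unfolding blocks_def
    proof (intro exI[of _ "\<lambda>i. Max ` \<H> (D i)"] conjI allI impI)
      show "omega_large j (Max ` \<H> (D i))" if "i < p" for i using \<H>(2) D(1) that by blast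
      show "Max ` \<H> (D i) \<lless> Max ` \<H> (D j)" if "i < j" "j < p" for i j
        using sep_subset[OF DD[OF that] sub_D sub_D] that by simp
    qed auto
    then have "blocks (omega_large j) (Max B) (\<Union>i<p. Max ` \<H> (D i))"
      by (rule blocks_mono[OF _ subset_refl xp])
    moreover have "(\<Union>i<p. Max ` \<H> (D i)) \<subseteq> Max ` \<F>"
      using D(1) unfolding \<F>_def by blast
    moreover have "{Max B} \<lless> (\<Union>i<p. Max ` \<H> (D i))"
      unfolding sep_def
    proof (intro ballI)
      fix x y assume "x \<in> {Max B}" "y \<in> (\<Union>i<p. Max ` \<H> (D i))"
      then obtain i where i: "i < p" "y \<in> D i" and "x = Max B" using sub_D by fast
      then show "x < y" using sepD[OF AD[OF i(1)] xA i(2)] by simp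
    qed
    moreover have "Max B \<in> Max ` \<F>" using A(1) B unfolding \<F>_def by blast
    ultimately show ?thesis by (rule omega_large_SucI[rotated])
  qed
  ultimately show ?case by blast
qed

section \<open>Induction on the sum of the two exponents\<close>

lemma ramsey_omega_power:
  fixes P :: "nat \<Rightarrow> nat \<Rightarrow> bool" and d :: "bool \<Rightarrow> nat"
  shows "\<lbrakk>finite X; X \<subseteq> {3..}; omega_large (81 * (d True + d False)) X\<rbrakk> \<Longrightarrow>
    \<exists>e Y. Y \<subseteq> X \<and> omega_large (d e) Y \<and> monochromatic e P Y"
proof (induction "d True + d False" arbitrary: d X)
  case 0
  then obtain x where "x \<in> X" using omega_large_nonempty by blast
  then show ?case using 0 by (intro exI[of _ True] exI[of _ "{x}"]) (auto simp: monochromatic_def)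
next
  case (Suc m)
  show ?case
  proof (cases "\<exists>e. d e = 0")
    case True
    then obtain e where e: "d e = 0" ..
    obtain x where "x \<in> X" using omega_large_nonempty[OF Suc.prems(3)] by blast
    then show ?thesis using e by (intro exI[of _ e] exI[of _ "{x}"]) (auto simp: monochromatic_def)
  next
    case False
    then have pos: "0 < d e" for e by auto
    \<comment> \<open>The cost \<open>9 * 9\<close> buys maxima that are
      \<open>omega^9\<close>-large, as \<open>ramsey_omega\<close> requires; the blocks keep
      exponent \<open>81 * m\<close> for the induction hypothesis.\<close>
    have "81 * (d True + d False) = 81 * m + 9 * 9" using Suc.hyps(2)[symmetric] by simp
    then have "omega_large (81 * m + 9 * 9) X" using Suc.prems(3) by simp
    then obtain \<F> where \<F>: "grouping P (81 * m) X \<F>" "omega_large 9 (Max ` \<F>)"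
      using grouping_omega_power[OF Suc.prems(1,2)] by blast
    note gr = groupingD[OF \<F>(1)]
    have fin: "finite A" and ne: "A \<noteq> {}" if "A \<in> \<F>" for A
      using gr(1,2)[OF that] Suc.prems(1) finite_subset omega_large_nonempty by blast+
    have sep_iff: "A \<lless> B \<longleftrightarrow> Max A < Max B" if "A \<in> \<F>" "B \<in> \<F>" for A B
      using grouping_sep_iff[OF \<F>(1) Suc.prems(1) that] .
    define F where "F = inv_into \<F> Max"
    have F: "F p \<in> \<F>" "Max (F p) = p" if "p \<in> Max ` \<F>" for p
      using that by (simp_all add: F_def inv_into_into f_inv_into_f)
    \<comment> \<open>For \<open>p < q\<close> the product of the two nonempty blocks has a single
      colour, which the universal quantifier reads off.\<close>
    define Q where "Q p q = (\<forall>x\<in>F p. \<forall>y\<in>F q. P x y)" for p q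
    have Q: "P x y = Q p q" if "p \<in> Max ` \<F>" "q \<in> Max ` \<F>" "p < q" "x \<in> F p" "y \<in> F q" for p q x y
    proof -
      have "F p \<lless> F q" using sep_iff F that(1-3) by simp
      then have "constant_on_product P (F p) (F q)" using gr(4) F that(1,2) by blast
      then obtain e where "\<forall>x\<in>F p. \<forall>y\<in>F q. P x y = e" unfolding constant_on_product_def ..
      then show ?thesis using that(4,5) unfolding Q_def by auto
    qed
    have maxX: "Max ` \<F> \<subseteq> X"
      using fin ne gr(1) Max_in by blast
    obtain e H where H: "H \<subseteq> Max ` \<F>" "omega_large 1 H" "monochromatic e Q H"
      using ramsey_omega[OF finite_subset[OF maxX Suc.prems(1)] subset_trans[OF maxX Suc.prems(2)] \<F>(2)] .
    define d' where "d' = d(e := d e - 1)"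
    have m: "m = d' True + d' False"
      using Suc.hyps(2) pos[of e] by (cases e) (auto simp: d'_def)
    have "\<exists>c Y. Y \<subseteq> F p \<and> omega_large (d' c) Y \<and> monochromatic c P Y" if "p \<in> H" for p
    proof -
      have Fp: "F p \<in> \<F>" using F(1) H(1) that by blast
      show ?thesis
        using gr(1,2)[OF Fp] fin[OF Fp] Suc.prems(2) m by (intro Suc.hyps(1)) auto
    qed
    then have "\<forall>p\<in>H. \<exists>c Y. Y \<subseteq> F p \<and> omega_large (d' c) Y \<and> monochromatic c P Y" by blast
    then obtain c where "\<forall>p\<in>H. \<exists>Y. Y \<subseteq> F p \<and> omega_large (d' (c p)) Y \<and> monochromatic (c p) P Y"
      by (rule bchoice[THEN exE])
    then obtain Y where "\<forall>p\<in>H. Y p \<subseteq> F p \<and> omega_large (d' (c p)) (Y p) \<and> monochromatic (c p) P (Y p)"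
      by (rule bchoice[THEN exE])
    then have Y: "Y p \<subseteq> F p" "omega_large (d' (c p)) (Y p)" "monochromatic (c p) P (Y p)" if "p \<in> H" for p
      using that by auto
    have YX: "Y p \<subseteq> X" if "p \<in> H" for p
    proof -
      have "F p \<in> \<F>" using F(1) H(1) that by blast
      with Y(1)[OF that] show ?thesis by (intro order_trans[OF _ gr(1)])
    qed
    show ?thesis
    proof (cases "\<exists>p\<in>H. c p \<noteq> e")
      case True
      \<comment> \<open>Only the exponent of \<open>e\<close> was lowered, so this
        \<open>Y p\<close> is already large enough for its own colour.\<close>
      then obtain p where "p \<in> H" "c p \<noteq> e" ..
      then show ?thesis using Y(2,3)[of p] YX[of p] by (auto simp: d'_def)
    next
      case False
      then have Ye: "omega_large (d e - 1) (Y p)" "monochromatic e P (Y p)" if "p \<in> H" for p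
        using Y(2,3)[OF that] that by (auto simp: d'_def)
      have sepF: "F p \<lless> F q" if "p \<in> H" "q \<in> H" "p < q" for p q
        using that sep_iff F H(1) by (metis subsetD)
      have sepY: "Y p \<lless> Y q" if "p \<in> H" "q \<in> H" "p < q" for p q
        using that by (intro sep_subset[OF sepF Y(1) Y(1)])
      have "monochromatic e P (\<Union>p\<in>H. Y p)"
        unfolding monochromatic_def
      proof (intro ballI impI)
        fix x y assume "x \<in> (\<Union>p\<in>H. Y p)" "y \<in> (\<Union>p\<in>H. Y p)" and xy: "x < y"
        then obtain p q where pq: "p \<in> H" "x \<in> Y p" "q \<in> H" "y \<in> Y q" by blast
        consider "p = q" | "p < q" | "q < p" by linarith
        then show "P x y = e"
        proof cases
          case 1
          then show ?thesis using Ye(2)[of p] pq xy by (auto simp: monochromatic_def)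
        next
          case 2
          have "p \<in> Max ` \<F>" "q \<in> Max ` \<F>" using H(1) pq(1,3) by auto
          moreover have "x \<in> F p" "y \<in> F q" using Y(1) pq by auto
          ultimately have "P x y = Q p q" using 2 by (intro Q)
          then show ?thesis using H(3) pq 2 by (auto simp: monochromatic_def)
        next
          case 3
          then show ?thesis using sepD[OF sepY[OF pq(3,1)] pq(4,2)] xy by simp
        qed
      qed
      moreover have "omega_large (d e) (\<Union>p\<in>H. Y p)"
      proof -
        have "omega_large (Suc 0) H" using H(2) by simp
        then obtain p where p: "p \<in> H" "blocks (omega_large 0) p (H \<inter> {p<..})" by (rule omega_large_SucE)
        obtain q where q: "\<And>i. i < p \<Longrightarrow> q i \<in> H \<inter> {p<..}" "\<And>i j. i < j \<Longrightarrow> j < p \<Longrightarrow> q i < q j"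
          using blocks_transversal[OF p(2)] by blast
        \<comment> \<open>Any point of \<open>Y p\<close> can be the root: it is at most
          \<open>p\<close>, the maximum of \<open>F p\<close>, so the \<open>p\<close> later sets
          \<open>Y (q i)\<close> suffice.\<close>
        obtain x where x: "x \<in> Y p" using omega_large_nonempty[OF Ye(1)[OF p(1)]] by blast
        have "p \<in> Max ` \<F>" using H(1) p(1) by blast
        note Fp = F[OF this]
        have "x \<in> F p" using x Y(1)[OF p(1)] by blast
        then have "x \<le> p" using Max_ge[OF fin[OF Fp(1)]] Fp(2) by fastforce
        have "blocks (omega_large (d e - 1)) p (\<Union>i<p. Y (q i))"
          unfolding blocks_def
        proof (intro exI[of _ "\<lambda>i. Y (q i)"] conjI allI impI)
          show "omega_large (d e - 1) (Y (q i))" if "i < p" for i using Ye(1) q(1)[OF that] by blast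
          show "Y (q i) \<lless> Y (q j)" if "i < j" "j < p" for i j
            using sepY[of "q i" "q j"] q(1)[of i] q(1)[of j] q(2)[OF that] that by simp
        qed auto
        then have "blocks (omega_large (d e - 1)) x (\<Union>i<p. Y (q i))"
          by (rule blocks_mono[OF _ subset_refl \<open>x \<le> p\<close>])
        moreover have "(\<Union>i<p. Y (q i)) \<subseteq> (\<Union>p\<in>H. Y p)" using q(1) by blast
        moreover have "{x} \<lless> (\<Union>i<p. Y (q i))"
        proof -
          have "{x} \<lless> Y (q i)" if "i < p" for i
            using x q(1)[OF that] p(1) by (intro sep_subset[OF sepY[of p "q i"]]) auto
          then show ?thesis unfolding sep_def by blast
        qed
        moreover have "x \<in> (\<Union>p\<in>H. Y p)" using p(1) x by blast
        ultimately have "omega_large (Suc (d e - 1)) (\<Union>p\<in>H. Y p)" by (rule omega_large_SucI[rotated])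
        then show ?thesis using pos[of e] by simp
      qed
      moreover have "(\<Union>p\<in>H. Y p) \<subseteq> X" using YX by blast
      ultimately show ?thesis by blast
    qed
  qed
qed

theorem theorem1p6:
  fixes n :: nat and X :: "nat set"
  assumes "finite X" and "X \<noteq> {}" and "Min X \<ge> 3"
    and "large (omega_pow (300 * n)) X"
  shows "RT22_large (omega_pow n) X"
  unfolding RT22_large_def
proof
  fix P :: "nat \<Rightarrow> nat \<Rightarrow> bool"
  have X3: "X \<subseteq> {3..}" using assms(1,3) by (auto intro: order_trans[OF _ Min_le])
  have "omega_large (300 * n) X" using assms(1,4) by (rule large_imp_omega_large)
  \<comment> \<open>Both colours get exponent \<open>n\<close>, which costs
    \<open>162 * n <= 300 * n\<close>.\<close>
  then have "omega_large (81 * (n + n)) X" by (rule omega_large_antimono) (use X3 in simp_all)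
  then obtain e Y where Y: "Y \<subseteq> X" "omega_large n Y" "monochromatic e P Y"
    using ramsey_omega_power[OF assms(1) X3, of "\<lambda>_. n" P] by blast
  obtain Z where Z: "Z \<subseteq> Y" "large (omega_pow n) Z" using Y(2) by (rule omega_large_imp_large)
  have "homogeneous P Z"
    unfolding homogeneous_def using Y(3) Z(1) by (auto simp: monochromatic_def intro!: exI[of _ e])
  with Y(1) Z show "\<exists>Y \<subseteq> X. large (omega_pow n) Y \<and> homogeneous P Y" by blast
qed

end
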